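(* For all integers $n\geq 1$, $$\overline{OPT}_4(2n)=2\cdot \overline{OPT}_8(n).$$
   Context: For a positive integer $m$ let $f_m:=(q^m;q^m)_\infty=\prod_{i\ge 1}(1-q^{mi})$ (as a formal power series in $q$). For a positive integer $k$ and integers $n\ge 0$, $\overline{OPT}_k(n)$ denotes the number of overpartition $k$-tuples of $n$ with all parts odd: $k$-tuples $(\xi_1,\dots,\xi_k)$ of overpartitions (partitions in which the first occurrence of each part size may be overlined) with all parts odd and total sum of all parts equal to $n$. Its generating function is $$\sum_{n\geq 0}\overline{OPT}_k(n)q^n=\frac{f_{2}^{3k}}{f_{1}^{2k}f_{4}^{k}}.$$ *)

theory Defs
  imports "HOL-Library.Multiset"
begin

text \<open>An overpartition is a pair \<open>(M, S)\<close>: \<open>M\<close> is the multiset of its (positive) parts, and \<open>S\<close>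
  is the set of those part sizes whose first occurrence is overlined.\<close>

type_synonym overpartition = "nat multiset \<times> nat set"

definition is_overpartition :: "overpartition \<Rightarrow> bool" where
  "is_overpartition \<xi> \<longleftrightarrow> (\<forall>p \<in># fst \<xi>. 0 < p) \<and> snd \<xi> \<subseteq> set_mset (fst \<xi>)"

definition weight :: "overpartition \<Rightarrow> nat" where
  "weight \<xi> = sum_mset (fst \<xi>)"

definition odd_overpartition_tuples :: "nat \<Rightarrow> nat \<Rightarrow> overpartition list set" where
  "odd_overpartition_tuples k n =
     {\<xi>s. length \<xi>s = k \<and>
          (\<forall>\<xi> \<in> set \<xi>s. is_overpartition \<xi> \<and> (\<forall>p \<in># fst \<xi>. odd p)) \<and>
          sum_list (map weight \<xi>s) = n}"

definition OPT :: "nat \<Rightarrow> nat \<Rightarrow> nat" where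
  "OPT k n = card (odd_overpartition_tuples k n)"

text \<open>The cardinality in the definition of \<open>OPT\<close> is that of a finite set.\<close>

lemma finite_overpartitions_weight_le:
  "finite {\<xi>. is_overpartition \<xi> \<and> weight \<xi> \<le> n}"
proof (rule finite_subset)
  let ?L = "{xs :: nat list. set xs \<subseteq> {..n} \<and> length xs \<le> n}"
  show "finite (mset ` ?L \<times> Pow {..n})"
    by (intro finite_cartesian_product finite_imageI finite_lists_length_le) auto
  have "M \<in> mset ` ?L \<and> S \<subseteq> {..n}"
    if op: "is_overpartition (M, S)" and w: "weight (M, S) \<le> n" for M S
  proof -
    obtain xs where xs: "M = mset xs" using ex_mset[of M] by auto
    have pos: "\<forall>p \<in> set xs. 0 < p" and S: "S \<subseteq> set xs" and sum: "sum_list xs \<le> n"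
      using op w by (auto simp: is_overpartition_def weight_def xs sum_mset_sum_list)
    have "set xs \<subseteq> {..n}"
      using sum member_le_sum_list[of _ xs] by (auto intro: order_trans)
    moreover have "length xs \<le> sum_list xs"
      using pos by (induction xs) auto
    ultimately show ?thesis
      using S sum xs by (blast intro: order_trans)
  qed
  then show "{\<xi>. is_overpartition \<xi> \<and> weight \<xi> \<le> n} \<subseteq> mset ` ?L \<times> Pow {..n}"
    by auto
qed

lemma finite_odd_overpartition_tuples: "finite (odd_overpartition_tuples k n)"
proof (rule finite_subset)
  let ?A = "{\<xi>. is_overpartition \<xi> \<and> weight \<xi> \<le> n}"
  show "finite {\<xi>s. set \<xi>s \<subseteq> ?A \<and> length \<xi>s = k}"
    by (intro finite_lists_length_eq finite_overpartitions_weight_le)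
  have "weight \<xi> \<le> sum_list (map weight \<xi>s)" if "\<xi> \<in> set \<xi>s" for \<xi> \<xi>s
    using that by (simp add: member_le_sum_list)
  then show "odd_overpartition_tuples k n \<subseteq> {\<xi>s. set \<xi>s \<subseteq> ?A \<and> length \<xi>s = k}"
    by (auto simp: odd_overpartition_tuples_def)
qed

end

theory Submission
  imports Defs "HOL-Computational_Algebra.Formal_Power_Series"
begin

unbundle fps_syntax

text \<open>
  Let \<open>O(q) = \<Prod>\<^sub>i (1 + q\<^sup>2\<^sup>i\<^sup>+\<^sup>1) / (1 - q\<^sup>2\<^sup>i\<^sup>+\<^sup>1)\<close> be the generating function of the overpartitions
  with odd parts, so that \<open>OPT k n\<close> is the coefficient of \<open>q\<^sup>n\<close> in \<open>O(q)\<^sup>k\<close>, and note \<open>O(q) O(-q) = 1\<close>.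
  By a limit of the \<open>q\<close>-binomial theorem, \<open>\<theta>(q) = \<Sum>\<^sub>x q\<^bsup>x\<^sup>2\<^esup>\<close> (\<open>x\<close> ranging over the integers) equals
  \<open>\<Prod>\<^sub>i (1 + q\<^sup>2\<^sup>i\<^sup>+\<^sup>1)\<^sup>2 (1 - q\<^sup>2\<^sup>i\<^sup>+\<^sup>2)\<close>. Hence \<open>O(q)\<^sup>2 = \<theta>(q) / \<theta>(-q)\<close> and
  \<open>\<theta>(q) \<theta>(-q) = \<theta>(-q\<^sup>2)\<^sup>2\<close>, while \<open>(x, y) \<mapsto> (x + y, x - y)\<close> gives
  \<open>\<theta>(q)\<^sup>2 + \<theta>(-q)\<^sup>2 = 2 \<theta>(q\<^sup>2)\<^sup>2\<close>. Dividing, \<open>O(q)\<^sup>2 + O(-q)\<^sup>2 = 2 O(q\<^sup>2)\<^sup>4\<close>, and squaring,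
  \<open>O(q)\<^sup>4 + O(-q)\<^sup>4 + 2 = 4 O(q\<^sup>2)\<^sup>8\<close>. The coefficients of \<open>q\<^sup>2\<^sup>n\<close> give the theorem; the
  constant \<open>2\<close> is the reason for excluding \<open>n = 0\<close>.
\<close>

section \<open>Convergence of formal power series\<close>

text \<open>Convergence of power series means that each coefficient is eventually constant, and
  coefficient n of a product depends only on the coefficients up to n of the factors.\<close>

lemma tendsto_mult_fps:
  fixes f g :: "'b \<Rightarrow> 'a :: ring_1 fps"
  assumes "(f \<longlongrightarrow> F) net" and "(g \<longlongrightarrow> G) net"
  shows "((\<lambda>x. f x * g x) \<longlongrightarrow> F * G) net"
proof (rule tendsto_fpsI)
  fix n
  have "\<forall>\<^sub>F x in net. \<forall>i\<in>{0..n}. f x $ i = F $ i"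
    using assms(1) by (subst eventually_ball_finite_distrib) (auto simp: tendsto_fps_iff)
  moreover have "\<forall>\<^sub>F x in net. \<forall>i\<in>{0..n}. g x $ i = G $ i"
    using assms(2) by (subst eventually_ball_finite_distrib) (auto simp: tendsto_fps_iff)
  ultimately show "\<forall>\<^sub>F x in net. (f x * g x) $ n = (F * G) $ n"
    by eventually_elim (auto simp: fps_mult_nth intro!: sum.cong)
qed

lemma tendsto_power_fps:
  fixes f :: "'b \<Rightarrow> 'a :: ring_1 fps"
  assumes "(f \<longlongrightarrow> F) net"
  shows "((\<lambda>x. f x ^ k) \<longlongrightarrow> F ^ k) net"
  by (induction k) (auto intro!: tendsto_mult_fps assms)

lemma tendsto_compose_fps:
  fixes f :: "'b \<Rightarrow> 'a :: ring_1 fps"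
  assumes "(f \<longlongrightarrow> F) net"
  shows "((\<lambda>x. f x oo h) \<longlongrightarrow> (F oo h)) net"
proof (rule tendsto_fpsI)
  fix n
  have "\<forall>\<^sub>F x in net. \<forall>i\<in>{0..n}. f x $ i = F $ i"
    using assms(1) by (subst eventually_ball_finite_distrib) (auto simp: tendsto_fps_iff)
  then show "\<forall>\<^sub>F x in net. (f x oo h) $ n = (F oo h) $ n"
    by eventually_elim (auto simp: fps_compose_nth intro!: sum.cong)
qed

text \<open>Factor number i is 1 modulo X^(i+1), so the factors with i > N do not affect coefficient
  N. The arbitrary cofactors \<open>g\<close> make the lemma apply to all the products used
  below.\<close>

lemma prod_one_plus_X_power_nth:
  fixes g :: "nat \<Rightarrow> 'a :: comm_ring_1 fps"
  assumes "N < m"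
  shows "(\<Prod>i<m. 1 + fps_X ^ Suc i * g i) $ N = (\<Prod>i<Suc N. 1 + fps_X ^ Suc i * g i) $ N"
proof -
  have "Suc N \<le> m" using assms by simp
  then show ?thesis
  proof (induction m rule: dec_induct)
    case (step m)
    let ?p = "\<Prod>i<m. 1 + fps_X ^ Suc i * g i"
    have "(\<Prod>i<Suc m. 1 + fps_X ^ Suc i * g i) = ?p + fps_X ^ Suc m * (?p * g m)"
      by (simp add: algebra_simps)
    then have "(\<Prod>i<Suc m. 1 + fps_X ^ Suc i * g i) $ N = ?p $ N"
      using step.hyps by (simp only: fps_add_nth fps_X_power_mult_nth) simp
    with step.IH show ?case by simp
  qed simp
qed

lemma convergent_prod_one_plus_X_power:
  fixes g :: "nat \<Rightarrow> 'a :: comm_ring_1 fps"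
  shows "convergent (\<lambda>n. \<Prod>i<n. 1 + fps_X ^ Suc i * g i)"
proof -
  have "(\<lambda>n. \<Prod>i<n. 1 + fps_X ^ Suc i * g i) \<longlonglongrightarrow>
        Abs_fps (\<lambda>N. (\<Prod>i<Suc N. 1 + fps_X ^ Suc i * g i) $ N)"
  proof (rule tendsto_fpsI, rule eventually_mono[OF eventually_gt_at_top])
    fix N m :: nat
    assume "N < m"
    then show "(\<Prod>i<m. 1 + fps_X ^ Suc i * g i) $ N =
        Abs_fps (\<lambda>N. (\<Prod>i<Suc N. 1 + fps_X ^ Suc i * g i) $ N) $ N"
      using prod_one_plus_X_power_nth[OF \<open>N < m\<close>, of g] by simp
  qed
  then show ?thesis by (rule convergentI)
qed

lemma fps_nth_compose_X_squared:
  fixes f :: "'a :: comm_ring_1 fps"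
  shows "(f oo fps_X\<^sup>2) $ n = (if even n then f $ (n div 2) else 0)"
proof -
  have "(f oo fps_X\<^sup>2) $ n = (\<Sum>i=0..n. if n = 2 * i then f $ i else 0)"
    unfolding fps_compose_nth power_mult[symmetric] fps_X_power_nth
    by (rule sum.cong) auto
  also have "\<dots> = (\<Sum>i=0..n. if i = n div 2 \<and> even n then f $ i else 0)"
    by (rule sum.cong) auto
  also have "\<dots> = (if even n then f $ (n div 2) else 0)"
    by (cases "even n") (auto simp: sum.delta)
  finally show ?thesis .
qed

section \<open>Generating functions of weighted sets\<close>

text \<open>An infinite fibre would be counted as 0, as \<open>card\<close> does; hence the
  finiteness hypotheses of the rules for unions and products.\<close>

definition gen_fun :: "'a set \<Rightarrow> ('a \<Rightarrow> nat) \<Rightarrow> rat fps" where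
  "gen_fun A w = Abs_fps (\<lambda>n. of_nat (card {x \<in> A. w x = n}))"

lemma gen_fun_nth: "gen_fun A w $ n = of_nat (card {x \<in> A. w x = n})"
  by (simp add: gen_fun_def)

lemma gen_fun_bij_betw:
  assumes "bij_betw f A B" and "\<And>x. x \<in> A \<Longrightarrow> v (f x) = w x"
  shows "gen_fun A w = gen_fun B v"
proof (rule fps_ext)
  fix n
  have "bij_betw f {x \<in> A. w x = n} {y \<in> B. v y = n}"
    using assms by (fastforce simp: bij_betw_def inj_on_def)
  then show "gen_fun A w $ n = gen_fun B v $ n"
    by (simp add: gen_fun_nth bij_betw_same_card)
qed

lemma gen_fun_shift: "gen_fun A (\<lambda>x. w x + m) = fps_X ^ m * gen_fun A w"
proof (rule fps_ext)
  fix n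
  have "{x \<in> A. w x + m = n} = (if n < m then {} else {x \<in> A. w x = n - m})"
    by auto
  then show "gen_fun A (\<lambda>x. w x + m) $ n = (fps_X ^ m * gen_fun A w) $ n"
    by (simp add: gen_fun_nth fps_X_power_mult_nth)
qed

lemma gen_fun_Un:
  assumes "\<And>n. finite {x \<in> A \<union> B. w x = n}" and "A \<inter> B = {}"
  shows "gen_fun (A \<union> B) w = gen_fun A w + gen_fun B w"
proof (rule fps_ext)
  fix n
  have eq: "{x \<in> A \<union> B. w x = n} = {x \<in> A. w x = n} \<union> {x \<in> B. w x = n}" by auto
  have "finite {x \<in> A. w x = n}" "finite {x \<in> B. w x = n}"
    using assms(1)[of n] unfolding eq by simp_all
  then have "card {x \<in> A \<union> B. w x = n} = card {x \<in> A. w x = n} + card {x \<in> B. w x = n}"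
    unfolding eq using assms(2) by (intro card_Un_disjoint) auto
  then show "gen_fun (A \<union> B) w $ n = (gen_fun A w + gen_fun B w) $ n"
    by (simp add: gen_fun_nth)
qed

lemma gen_fun_times:
  assumes "\<And>n. finite {x \<in> A. w x = n}" and "\<And>n. finite {y \<in> B. v y = n}"
  shows "gen_fun (A \<times> B) (\<lambda>(x, y). w x + v y) = gen_fun A w * gen_fun B v"
proof (rule fps_ext)
  fix n
  have "{p \<in> A \<times> B. (\<lambda>(x, y). w x + v y) p = n} =
        (\<Union>i\<in>{0..n}. {x \<in> A. w x = i} \<times> {y \<in> B. v y = n - i})"
    by auto
  also have "card \<dots> = (\<Sum>i=0..n. card ({x \<in> A. w x = i} \<times> {y \<in> B. v y = n - i}))"
    using assms by (intro card_UN_disjoint) auto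
  finally show "gen_fun (A \<times> B) (\<lambda>(x, y). w x + v y) $ n = (gen_fun A w * gen_fun B v) $ n"
    by (simp add: gen_fun_nth fps_mult_nth card_cartesian_product)
qed

section \<open>Overpartitions with odd parts\<close>

definition overpartitions_in :: "nat set \<Rightarrow> overpartition set" where
  "overpartitions_in S = {\<xi>. is_overpartition \<xi> \<and> set_mset (fst \<xi>) \<subseteq> S}"

lemma finite_overpartitions_in_weight: "finite {\<xi> \<in> overpartitions_in S. weight \<xi> = n}"
  by (rule finite_subset[OF _ finite_overpartitions_weight_le[of n]])
    (auto simp: overpartitions_in_def)

text \<open>Each of the two bijections adds one part \<open>m\<close>: an overlined one to an overpartition
  without overlined \<open>m\<close>, respectively a plain one.\<close>

lemma gen_fun_overpartitions_in_insert:
  assumes "0 < m" and "m \<notin> S"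
  shows "gen_fun (overpartitions_in (insert m S)) weight * (1 - fps_X ^ m) =
         gen_fun (overpartitions_in S) weight * (1 + fps_X ^ m)"
proof -
  define A where "A = overpartitions_in (insert m S)"
  define B where "B = overpartitions_in S"
  \<comment> \<open>An intermediate set: passing from \<open>B\<close> to \<open>U\<close> divides
    the series by 1 - X^m, passing from \<open>U\<close> to \<open>A\<close> multiplies it by 1 +
    X^m.\<close>
  define U where "U = {\<xi> \<in> A. m \<notin> snd \<xi>}"
  have fin: "finite {\<xi> \<in> A. weight \<xi> = n}" for n
    unfolding A_def by (rule finite_overpartitions_in_weight)
  have finU: "finite {\<xi> \<in> U. weight \<xi> = n}" for n
    by (rule finite_subset[OF _ fin[of n]]) (auto simp: U_def)
  have B: "B \<subseteq> U" using assms by (auto simp: A_def B_def U_def overpartitions_in_def is_overpartition_def)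
  have keep: "x \<in># M - {#m#}" if "x \<in># M" "x \<noteq> m" for x M
    using that by (simp add: in_diff_count)
  have overlined: "bij_betw (\<lambda>(M, T). (add_mset m M, insert m T)) U (A - U)"
    by (rule bij_betwI[where g = "\<lambda>(M, T). (M - {#m#}, T - {m})"])
      (use assms in \<open>auto simp: A_def U_def overpartitions_in_def is_overpartition_def
        intro!: keep dest!: in_diffD\<close>)
  have plain: "bij_betw (\<lambda>(M, T). (add_mset m M, T)) U (U - B)"
    by (rule bij_betwI[where g = "\<lambda>(M, T). (M - {#m#}, T)"])
      (use assms in \<open>auto simp: A_def B_def U_def overpartitions_in_def is_overpartition_def
        intro!: keep dest!: in_diffD\<close>)
  have "gen_fun A weight = gen_fun (U \<union> (A - U)) weight"
    by (rule arg_cong[where f = "\<lambda>A. gen_fun A weight"]) (auto simp: U_def)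
  also have "\<dots> = gen_fun U weight + gen_fun (A - U) weight"
    by (rule gen_fun_Un) (auto intro: finite_subset[OF _ fin] simp: U_def)
  also have "gen_fun (A - U) weight = gen_fun U (\<lambda>\<xi>. weight \<xi> + m)"
    by (rule gen_fun_bij_betw[OF overlined, symmetric]) (auto simp: weight_def)
  finally have 1: "gen_fun A weight = gen_fun U weight * (1 + fps_X ^ m)"
    unfolding gen_fun_shift by (simp add: algebra_simps)
  have "gen_fun U weight = gen_fun (B \<union> (U - B)) weight"
    by (rule arg_cong[where f = "\<lambda>A. gen_fun A weight"]) (use B in auto)
  also have "\<dots> = gen_fun B weight + gen_fun (U - B) weight"
    by (rule gen_fun_Un) (use B in \<open>auto intro: finite_subset[OF _ finU]\<close>)
  also have "gen_fun (U - B) weight = gen_fun U (\<lambda>\<xi>. weight \<xi> + m)"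
    by (rule gen_fun_bij_betw[OF plain, symmetric]) (auto simp: weight_def)
  finally have 2: "gen_fun U weight * (1 - fps_X ^ m) = gen_fun B weight"
    unfolding gen_fun_shift by (simp add: algebra_simps)
  show ?thesis
    unfolding A_def[symmetric] B_def[symmetric] 1 2[symmetric] by (simp add: algebra_simps)
qed

lemma gen_fun_overpartitions_in_empty: "gen_fun (overpartitions_in {}) weight = 1"
proof (rule fps_ext)
  fix n
  have "{\<xi> \<in> overpartitions_in {}. weight \<xi> = n} = (if n = 0 then {({#}, {})} else {})"
    by (auto simp: overpartitions_in_def is_overpartition_def weight_def)
  then show "gen_fun (overpartitions_in {}) weight $ n = 1 $ n"
    by (simp add: gen_fun_nth)
qed

section \<open>Finite products and the series of odd overpartitions\<close>

definition odd_prod :: "nat \<Rightarrow> rat fps" where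
  "odd_prod n = (\<Prod>i<n. 1 + fps_X ^ (2 * i + 1))"

definition odd_prod_neg :: "nat \<Rightarrow> rat fps" where
  "odd_prod_neg n = (\<Prod>i<n. 1 - fps_X ^ (2 * i + 1))"

definition even_prod :: "nat \<Rightarrow> rat fps" where
  "even_prod n = (\<Prod>i<n. 1 - fps_X ^ (2 * Suc i))"

lemma gen_fun_overpartitions_in_odd:
  "gen_fun (overpartitions_in ((\<lambda>i. 2 * i + 1) ` {..<n})) weight * odd_prod_neg n = odd_prod n"
proof (induction n)
  case 0
  show ?case by (simp add: gen_fun_overpartitions_in_empty odd_prod_def odd_prod_neg_def)
next
  case (Suc n)
  let ?S = "(\<lambda>i. 2 * i + 1 :: nat) ` {..<n}"
  have S: "(\<lambda>i. 2 * i + 1) ` {..<Suc n} = insert (2 * n + 1) ?S"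
    by (simp add: lessThan_Suc)
  have "gen_fun (overpartitions_in (insert (2 * n + 1) ?S)) weight * (1 - fps_X ^ (2 * n + 1)) =
        gen_fun (overpartitions_in ?S) weight * (1 + fps_X ^ (2 * n + 1))"
    by (rule gen_fun_overpartitions_in_insert) auto
  then have "gen_fun (overpartitions_in (insert (2 * n + 1) ?S)) weight * odd_prod_neg (Suc n) =
        gen_fun (overpartitions_in ?S) weight * odd_prod_neg n * (1 + fps_X ^ (2 * n + 1))"
    by (simp add: odd_prod_neg_def mult_ac)
  then show ?case unfolding S Suc.IH by (simp add: odd_prod_def)
qed

definition odd_overpartition_series :: "rat fps" where
  "odd_overpartition_series = gen_fun (overpartitions_in {p. odd p}) weight"

text \<open>No part exceeds the weight N, and for n > N every odd number up to N is among the first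
  n odd numbers.\<close>

lemma odd_overpartition_series_limit:
  "(\<lambda>n. gen_fun (overpartitions_in ((\<lambda>i. 2 * i + 1) ` {..<n})) weight)
     \<longlonglongrightarrow> odd_overpartition_series"
proof (rule tendsto_fpsI, rule eventually_mono[OF eventually_gt_at_top])
  fix N n :: nat
  assume "N < n"
  have small: "p \<in> (\<lambda>i. 2 * i + 1) ` {..<n}"
    if "weight \<xi> = N" "odd p" "p \<in># fst \<xi>" for p \<xi>
  proof -
    have "p \<le> N"
      using that sum_mset.remove[of p "fst \<xi>"] by (simp add: weight_def)
    with \<open>odd p\<close> \<open>N < n\<close> show ?thesis by (auto elim!: oddE)
  qed
  have "set_mset (fst \<xi>) \<subseteq> (\<lambda>i. 2 * i + 1) ` {..<n} \<longleftrightarrow> set_mset (fst \<xi>) \<subseteq> {p. odd p}"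
    if "weight \<xi> = N" for \<xi>
    using small[OF that] by (auto simp: subset_iff)
  then have "{\<xi> \<in> overpartitions_in ((\<lambda>i. 2 * i + 1) ` {..<n}). weight \<xi> = N} =
             {\<xi> \<in> overpartitions_in {p. odd p}. weight \<xi> = N}"
    by (auto simp: overpartitions_in_def)
  then show "gen_fun (overpartitions_in ((\<lambda>i. 2 * i + 1) ` {..<n})) weight $ N =
      odd_overpartition_series $ N"
    by (simp add: odd_overpartition_series_def gen_fun_nth)
qed

lemma OPT_eq_nth_power: "of_nat (OPT k n) = (odd_overpartition_series ^ k) $ n"
proof -
  define T where "T k = {\<xi>s. length \<xi>s = k \<and> set \<xi>s \<subseteq> overpartitions_in {p. odd p}}" for k
  have T: "{\<xi>s \<in> T k. sum_list (map weight \<xi>s) = n} = odd_overpartition_tuples k n" for k n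
    by (auto simp: T_def odd_overpartition_tuples_def overpartitions_in_def subset_iff)
  have "gen_fun (T k) (\<lambda>\<xi>s. sum_list (map weight \<xi>s)) = odd_overpartition_series ^ k" for k
  proof (induction k)
    case 0
    have "{\<xi>s \<in> T 0. sum_list (map weight \<xi>s) = n} = (if n = 0 then {[]} else {})" for n
      by (auto simp: T_def)
    then show ?case by (intro fps_ext) (simp add: gen_fun_nth)
  next
    case (Suc k)
    \<comment> \<open>Splitting a tuple into head and tail turns one more component into one more
      factor of the series.\<close>
    have bij: "bij_betw (\<lambda>(\<xi>, \<xi>s). \<xi> # \<xi>s) (overpartitions_in {p. odd p} \<times> T k) (T (Suc k))"
      by (rule bij_betwI[where g = "\<lambda>\<xi>s. (hd \<xi>s, tl \<xi>s)"])
        (auto simp: T_def length_Suc_conv)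
    have "gen_fun (T (Suc k)) (\<lambda>\<xi>s. sum_list (map weight \<xi>s)) =
          gen_fun (overpartitions_in {p. odd p} \<times> T k)
            (\<lambda>(\<xi>, \<xi>s). weight \<xi> + sum_list (map weight \<xi>s))"
      by (rule gen_fun_bij_betw[OF bij, symmetric]) auto
    also have "\<dots> = odd_overpartition_series * odd_overpartition_series ^ k"
      unfolding Suc.IH[symmetric] unfolding odd_overpartition_series_def
      by (rule gen_fun_times)
        (simp_all add: T finite_overpartitions_in_weight finite_odd_overpartition_tuples)
    finally show ?case by simp
  qed
  from this[of k, symmetric] show ?thesis by (simp add: gen_fun_nth T OPT_def)
qed

section \<open>The $q$-binomial theorem\<close>

fun qbinomial :: "'a :: comm_ring_1 \<Rightarrow> nat \<Rightarrow> nat \<Rightarrow> 'a" where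
  "qbinomial q m 0 = 1"
| "qbinomial q 0 (Suc j) = 0"
| "qbinomial q (Suc m) (Suc j) = qbinomial q m (Suc j) + q ^ (m - j) * qbinomial q m j"

lemma qbinomial_eq_0: "m < j \<Longrightarrow> qbinomial q m j = 0"
  by (induction q m j rule: qbinomial.induct) auto

text \<open>Induction on m: the recurrence splits the sum for m + 1 into a times and q^m times the
  sum for m. The form homogeneous in \<open>a\<close> avoids inverting \<open>a\<close>.\<close>

lemma qbinomial_theorem:
  fixes a q :: "'a :: comm_ring_1"
  shows "(\<Prod>j<m. a + q ^ j) = (\<Sum>j\<le>m. qbinomial q m j * q ^ (j choose 2) * a ^ (m - j))"
proof (induction m)
  case 0
  show ?case by (simp add: numeral_2_eq_2)
next
  case (Suc m)
  have "(\<Sum>j\<le>Suc m. qbinomial q (Suc m) j * q ^ (j choose 2) * a ^ (Suc m - j)) =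
        a ^ Suc m + (\<Sum>j\<le>m. qbinomial q (Suc m) (Suc j) * q ^ (Suc j choose 2) * a ^ (m - j))"
    by (subst sum.atMost_Suc_shift) (simp add: numeral_2_eq_2)
  also have "(\<Sum>j\<le>m. qbinomial q (Suc m) (Suc j) * q ^ (Suc j choose 2) * a ^ (m - j)) =
        (\<Sum>j\<le>m. qbinomial q m (Suc j) * q ^ (Suc j choose 2) * a ^ (m - j)) +
        (\<Sum>j\<le>m. q ^ m * (qbinomial q m j * q ^ (j choose 2) * a ^ (m - j)))"
    unfolding sum.distrib[symmetric]
  proof (rule sum.cong[OF refl])
    fix j assume "j \<in> {..m}"
    \<comment> \<open>Here \<open>Suc j choose 2\<close> is j more than \<open>j choose 2\<close>,
      which cancels the -j because j \<le> m.\<close>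
    then have e: "q ^ (m - j) * q ^ (Suc j choose 2) = q ^ m * q ^ (j choose 2)"
      unfolding power_add[symmetric] by (simp add: numeral_2_eq_2)
    have "qbinomial q (Suc m) (Suc j) * q ^ (Suc j choose 2) * a ^ (m - j) =
        qbinomial q m (Suc j) * q ^ (Suc j choose 2) * a ^ (m - j) +
        (q ^ (m - j) * q ^ (Suc j choose 2)) * qbinomial q m j * a ^ (m - j)"
      by (simp add: algebra_simps)
    then show "qbinomial q (Suc m) (Suc j) * q ^ (Suc j choose 2) * a ^ (m - j) =
        qbinomial q m (Suc j) * q ^ (Suc j choose 2) * a ^ (m - j) +
        q ^ m * (qbinomial q m j * q ^ (j choose 2) * a ^ (m - j))"
      unfolding e by (simp add: mult_ac)
  qed
  also have "a ^ Suc m + ((\<Sum>j\<le>m. qbinomial q m (Suc j) * q ^ (Suc j choose 2) * a ^ (m - j)) +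
        (\<Sum>j\<le>m. q ^ m * (qbinomial q m j * q ^ (j choose 2) * a ^ (m - j)))) =
        (\<Sum>j\<le>Suc m. qbinomial q m j * q ^ (j choose 2) * a ^ (Suc m - j)) +
        q ^ m * (\<Sum>j\<le>m. qbinomial q m j * q ^ (j choose 2) * a ^ (m - j))"
    by (subst sum.atMost_Suc_shift) (simp add: sum_distrib_left numeral_2_eq_2)
  also have "(\<Sum>j\<le>Suc m. qbinomial q m j * q ^ (j choose 2) * a ^ (Suc m - j)) =
        a * (\<Sum>j\<le>m. qbinomial q m j * q ^ (j choose 2) * a ^ (m - j))"
    by (simp add: qbinomial_eq_0 sum_distrib_left Suc_diff_le mult_ac)
  finally show ?case using Suc.IH by (simp add: algebra_simps)
qed

text \<open>The quotient formula with denominators cleared. The two summands of the recurrence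
  contribute 1 - q^(m-j) and q^(m-j) (1 - q^(j+1)) times the product for m; these add up to 1 -
  q^(m+1).\<close>

lemma qbinomial_prod:
  fixes q :: "'a :: comm_ring_1"
  assumes "j \<le> m"
  shows "qbinomial q m j * (\<Prod>i<j. 1 - q ^ Suc i) * (\<Prod>i<m - j. 1 - q ^ Suc i) =
         (\<Prod>i<m. 1 - q ^ Suc i)"
  using assms
proof (induction q m j rule: qbinomial.induct)
  case (3 q m j)
  let ?P = "\<lambda>n. \<Prod>i<n. 1 - q ^ Suc i"
  have a: "qbinomial q m (Suc j) * ?P (Suc j) * ?P (m - j) = ?P m * (1 - q ^ (m - j))"
  \<comment> \<open>For j = m the induction hypothesis does not apply, but both sides are 0.\<close>
  proof (cases "j = m")
    case False
    then have "m - j = Suc (m - Suc j)" "Suc j \<le> m" using 3 by auto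
    then show ?thesis using 3(1) by (simp del: power_Suc add: mult_ac)
  qed (simp add: qbinomial_eq_0)
  have b: "qbinomial q m j * ?P j * ?P (m - j) = ?P m" using 3 by simp
  have e: "q ^ (m - j) * q ^ Suc j = q ^ Suc m"
    unfolding power_add[symmetric] using 3(3) by simp
  have "qbinomial q (Suc m) (Suc j) * ?P (Suc j) * ?P (Suc m - Suc j) =
     qbinomial q m (Suc j) * ?P (Suc j) * ?P (m - j) +
     q ^ (m - j) * (1 - q ^ Suc j) * (qbinomial q m j * ?P j * ?P (m - j))"
    by (simp del: power_Suc add: algebra_simps)
  also have "\<dots> = ?P m * (1 - q ^ (m - j) * q ^ Suc j)"
    unfolding a b by (simp del: power_Suc add: algebra_simps)
  finally show ?case unfolding e by simp
qed auto

section \<open>The product formula for the theta series\<close>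

definition theta :: "rat fps" where
  "theta = gen_fun (UNIV :: int set) (\<lambda>x. nat (x\<^sup>2))"

lemma abs_le_power2_int: "\<bar>x\<bar> \<le> x\<^sup>2" for x :: int
proof (cases "x = 0")
  case False
  then have "\<bar>x\<bar> \<le> \<bar>x\<bar>\<^sup>2" by (intro self_le_power) auto
  then show ?thesis by simp
qed simp

lemma finite_theta_fibre: "finite {x \<in> (UNIV :: int set). nat (x\<^sup>2) = n}"
proof (rule finite_subset)
  show "{x \<in> (UNIV :: int set). nat (x\<^sup>2) = n} \<subseteq> {- int n..int n}"
  proof clarify
    fix x :: int
    show "x \<in> {- int (nat (x\<^sup>2))..int (nat (x\<^sup>2))}"
      using abs_le_power2_int[of x] by auto
  qed
qed simp

text \<open>The index j stands for the integer x = j - n between -n and n. Since |x| \<le> x^2,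
  every solution of x^2 = N lies in this range once n > N.\<close>

lemma partial_theta_limit:
  "(\<lambda>n. \<Sum>j\<le>2 * n. fps_X ^ nat ((int j - int n)\<^sup>2)) \<longlonglongrightarrow> theta"
proof (rule tendsto_fpsI, rule eventually_mono[OF eventually_gt_at_top])
  fix N n :: nat
  assume "N < n"
  let ?J = "{j \<in> {..2 * n}. nat ((int j - int n)\<^sup>2) = N}"
  have "bij_betw (\<lambda>j. int j - int n) ?J {x \<in> UNIV. nat (x\<^sup>2) = N}"
  proof (rule bij_betwI[where g = "\<lambda>x. nat (x + int n)"])
    have "\<bar>x\<bar> \<le> int n" if "nat (x\<^sup>2) = N" for x :: int
    proof -
      have "\<bar>x\<bar> \<le> x\<^sup>2" by (rule abs_le_power2_int)
      also have "\<dots> = int N" using that by auto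
      finally show ?thesis using \<open>N < n\<close> by simp
    qed
    then show "(\<lambda>x. nat (x + int n)) \<in> {x \<in> UNIV. nat (x\<^sup>2) = N} \<rightarrow> ?J"
      and "\<And>x. x \<in> {x \<in> UNIV. nat (x\<^sup>2) = N} \<Longrightarrow> int (nat (x + int n)) - int n = x"
      by (force simp: abs_le_iff)+
  qed auto
  then have "card ?J = card {x :: int \<in> UNIV. nat (x\<^sup>2) = N}" by (rule bij_betw_same_card)
  moreover have "(\<Sum>j\<le>2 * n. fps_X ^ nat ((int j - int n)\<^sup>2)) $ N =
      (\<Sum>j\<le>2 * n. if nat ((int j - int n)\<^sup>2) = N then 1 else (0::rat))"
    by (auto simp: fps_sum_nth intro!: sum.cong)
  moreover have "\<dots> = of_nat (card ?J)"
    by (simp add: sum.If_cases Int_def)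
  ultimately show "(\<Sum>j\<le>2 * n. fps_X ^ nat ((int j - int n)\<^sup>2)) $ N = theta $ N"
    by (simp add: theta_def gen_fun_nth)
qed

text \<open>This is the \<open>q\<close>-binomial theorem for \<open>q = X\<^sup>2\<close>, \<open>m = 2 n\<close> and \<open>a = X\<^sup>2\<^sup>n\<^sup>-\<^sup>1\<close>, divided by the
  power of \<open>X\<close> that the products and all summands have in common.\<close>

lemma odd_prod_squared:
  "(odd_prod n)\<^sup>2 = (\<Sum>j\<le>2 * n. qbinomial (fps_X\<^sup>2) (2 * n) j * fps_X ^ nat ((int j - int n)\<^sup>2))"
proof -
  \<comment> \<open>The common power of X: factor number j is X^(2n-1) + X^(2j), which yields X^(2j)
    for j < n and X^(2n-1) for j \<ge> n. Each half leaves the product of the same 1 + X^(odd), the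
    first half in reverse order.\<close>
  let ?e = "n * (n - 1) + n * (2 * n - 1)"
  have pred: "int (k * (k - 1)) = int k * (int k - 1)" for k
    by (cases k) (auto simp: algebra_simps)
  have "(\<Prod>j<2 * n. (fps_X :: rat fps) ^ (2 * n - 1) + (fps_X\<^sup>2) ^ j) =
        (\<Prod>j<n. fps_X ^ (2 * n - 1) + (fps_X\<^sup>2) ^ j) * (\<Prod>j<n. fps_X ^ (2 * n - 1) + (fps_X\<^sup>2) ^ (n + j))"
    using prod.atLeastLessThan_concat[of 0 n "2 * n" "\<lambda>j. (fps_X :: rat fps) ^ (2 * n - 1) + (fps_X\<^sup>2) ^ j"]
      prod.shift_bounds_nat_ivl[of "\<lambda>j. (fps_X :: rat fps) ^ (2 * n - 1) + (fps_X\<^sup>2) ^ j" 0 n n]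
    by (simp add: atLeast0LessThan mult_2 add.commute)
  also have "(\<Prod>j<n. (fps_X :: rat fps) ^ (2 * n - 1) + (fps_X\<^sup>2) ^ (n + j)) =
      (\<Prod>j<n. fps_X ^ (2 * n - 1) * (1 + fps_X ^ (2 * j + 1)))"
  proof (rule prod.cong[OF refl])
    fix j assume "j \<in> {..<n}"
    then have "2 * (n + j) = (2 * n - 1) + (2 * j + 1)" by auto
    then have "((fps_X :: rat fps)\<^sup>2) ^ (n + j) = fps_X ^ (2 * n - 1) * fps_X ^ (2 * j + 1)"
      unfolding power_mult[symmetric] power_add[symmetric] by (rule arg_cong)
    then show "(fps_X :: rat fps) ^ (2 * n - 1) + (fps_X\<^sup>2) ^ (n + j) =
        fps_X ^ (2 * n - 1) * (1 + fps_X ^ (2 * j + 1))"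
      by (simp only: distrib_left mult_1_right)
  qed
  also have "\<dots> = fps_X ^ (n * (2 * n - 1)) * odd_prod n"
    by (simp only: prod.distrib prod_constant odd_prod_def card_lessThan power_mult[symmetric] mult.commute)
  also have "(\<Prod>j<n. (fps_X :: rat fps) ^ (2 * n - 1) + (fps_X\<^sup>2) ^ j) =
      (\<Prod>j<n. fps_X ^ (2 * j) * (1 + fps_X ^ (2 * (n - Suc j) + 1)))"
  proof (rule prod.cong[OF refl])
    fix j assume "j \<in> {..<n}"
    then have "2 * n - 1 = 2 * j + (2 * (n - Suc j) + 1)" by auto
    then have "(fps_X :: rat fps) ^ (2 * n - 1) = fps_X ^ (2 * j) * fps_X ^ (2 * (n - Suc j) + 1)"
      unfolding power_add[symmetric] by (rule arg_cong)
    then show "(fps_X :: rat fps) ^ (2 * n - 1) + (fps_X\<^sup>2) ^ j =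
        fps_X ^ (2 * j) * (1 + fps_X ^ (2 * (n - Suc j) + 1))"
      by (simp only: distrib_left mult_1_right power_mult[symmetric] add.commute)
  qed
  also have "\<dots> = fps_X ^ (\<Sum>j<n. 2 * j) * odd_prod n"
    unfolding prod.distrib power_sum odd_prod_def
    by (simp only: prod.nat_diff_reindex[of "\<lambda>j. 1 + fps_X ^ (2 * j + 1)"])
  also have "(\<Sum>j<n. 2 * j) = n * (n - 1)"
  proof (induction n)
    case (Suc n)
    then show ?case by (cases n) simp_all
  qed simp
  finally have "fps_X ^ ?e * (odd_prod n)\<^sup>2 =
      (\<Prod>j<2 * n. (fps_X :: rat fps) ^ (2 * n - 1) + (fps_X\<^sup>2) ^ j)"
    by (simp add: power_add power2_eq_square mult_ac)
  also have "\<dots> = (\<Sum>j\<le>2 * n. qbinomial (fps_X\<^sup>2) (2 * n) j * (fps_X\<^sup>2) ^ (j choose 2) *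
      (fps_X ^ (2 * n - 1)) ^ (2 * n - j))"
    by (rule qbinomial_theorem)
  also have "\<dots> = (\<Sum>j\<le>2 * n. fps_X ^ ?e *
      (qbinomial (fps_X\<^sup>2) (2 * n) j * fps_X ^ nat ((int j - int n)\<^sup>2)))"
  proof (rule sum.cong[OF refl])
    fix j assume "j \<in> {..2 * n}"
    have "2 * (j choose 2) = j * (j - 1)"
      by (cases j) (auto simp: choose_two)
    \<comment> \<open>Completing the square in j. This is checked over the integers because of the
      subtractions; n = 0, where \<open>2 * n - 1\<close> truncates, is treated apart.\<close>
    moreover have "j * (j - 1) + (2 * n - 1) * (2 * n - j) = ?e + nat ((int j - int n)\<^sup>2)"
    proof (cases "n = 0")
      case False
      then have "int (2 * n - 1) = 2 * int n - 1" by auto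
      moreover have "int (nat ((int j - int n)\<^sup>2)) = (int j - int n)\<^sup>2" by simp
      moreover have "int (2 * n - j) = 2 * int n - int j"
        using \<open>j \<in> {..2 * n}\<close> by auto
      ultimately have "int (j * (j - 1) + (2 * n - 1) * (2 * n - j)) =
          int (?e + nat ((int j - int n)\<^sup>2))"
        unfolding of_nat_add pred of_nat_mult[of "2 * n - 1"] of_nat_mult[of n "2 * n - 1"]
        by (simp only:) (simp add: power2_eq_square algebra_simps)
      then show ?thesis by (simp only: of_nat_eq_iff)
    qed (use \<open>j \<in> {..2 * n}\<close> in auto)
    ultimately have "((fps_X :: rat fps)\<^sup>2) ^ (j choose 2) * (fps_X ^ (2 * n - 1)) ^ (2 * n - j) =
        fps_X ^ ?e * fps_X ^ nat ((int j - int n)\<^sup>2)"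
      unfolding power_mult[symmetric] power_add[symmetric] by (simp only:)
    then show "qbinomial ((fps_X :: rat fps)\<^sup>2) (2 * n) j * (fps_X\<^sup>2) ^ (j choose 2) *
          (fps_X ^ (2 * n - 1)) ^ (2 * n - j) =
        fps_X ^ ?e * (qbinomial (fps_X\<^sup>2) (2 * n) j * fps_X ^ nat ((int j - int n)\<^sup>2))"
      by (simp only: mult.assoc mult.left_commute)
  qed
  finally show ?thesis
    unfolding sum_distrib_left[symmetric] by (simp del: power_add)
qed

section \<open>Passage to the limit in the q-binomial theorem\<close>

lemma even_prod_eq: "even_prod n = (\<Prod>i<n. 1 + fps_X ^ Suc i * (- (fps_X ^ Suc i)))"
  by (auto simp: even_prod_def mult_2 power_add intro!: prod.cong)

lemma even_prod_nth_0: "even_prod n $ 0 = 1"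
  by (induction n) (simp_all add: even_prod_def)

lemma fps_X_power_dvd_cancel:
  fixes f g :: "'a :: field fps"
  assumes "fps_X ^ k dvd f * g" and "g $ 0 \<noteq> 0"
  shows "fps_X ^ k dvd f"
proof -
  have "g dvd 1" using assms(2) by (simp add: fps_is_unit_iff)
  then show ?thesis using assms(1) by (simp add: dvd_mult_unit_iff)
qed

lemma fps_X_power_dvdI:
  fixes f :: "'a :: comm_ring_1 fps"
  assumes "\<And>i. i < k \<Longrightarrow> f $ i = 0"
  shows "fps_X ^ k dvd f"
proof
  show "f = fps_X ^ k * fps_shift k f"
    by (rule fps_ext) (use assms in \<open>auto simp: fps_X_power_mult_nth\<close>)
qed

text \<open>The coefficient is the quotient of \<open>even_prod (2 * n)\<close> by
  \<open>even_prod j * even_prod (2 * n - j)\<close>. All these products, and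
  \<open>even_prod n\<close>, agree modulo X^N because their lengths are at least N. The denominator
  is a unit, so the congruence may be proved after multiplying by it.\<close>

lemma qbinomial_even_prod_cong:
  assumes "N \<le> j" and "N \<le> n" and "j \<le> 2 * n" and "N \<le> 2 * n - j"
  shows "fps_X ^ N dvd qbinomial (fps_X\<^sup>2) (2 * n) j * even_prod n - 1"
proof (rule fps_X_power_dvd_cancel)
  have nth: "even_prod a $ i = even_prod (Suc i) $ i" if "i < a" for a i
    unfolding even_prod_eq using that by (rule prod_one_plus_X_power_nth)
  have cong: "fps_X ^ N dvd even_prod a - even_prod b" if "N \<le> a" "N \<le> b" for a b
    by (rule fps_X_power_dvdI) (use that nth[of _ a] nth[of _ b] in simp)
  have ev: "(\<Prod>i<k. 1 - ((fps_X :: rat fps)\<^sup>2) ^ Suc i) = even_prod k" for k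
    by (simp only: even_prod_def power_mult[symmetric])
  have "qbinomial (fps_X\<^sup>2) (2 * n) j * even_prod j * even_prod (2 * n - j) = even_prod (2 * n)"
    using qbinomial_prod[OF assms(3), of "fps_X\<^sup>2 :: rat fps"] by (simp only: ev)
  then have "(qbinomial (fps_X\<^sup>2) (2 * n) j * even_prod n - 1) * (even_prod j * even_prod (2 * n - j)) =
      even_prod (2 * n) * even_prod n - even_prod j * even_prod (2 * n - j)"
    by (simp add: algebra_simps)
  also have "\<dots> = even_prod (2 * n) * (even_prod n - even_prod j) +
      even_prod j * (even_prod (2 * n) - even_prod (2 * n - j))"
    by (simp add: algebra_simps)
  also have "fps_X ^ N dvd \<dots>"
    using assms by (intro dvd_add dvd_mult cong) auto
  finally show "fps_X ^ N dvd (qbinomial (fps_X\<^sup>2) (2 * n) j * even_prod n - 1) *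
      (even_prod j * even_prod (2 * n - j))" .
  show "(even_prod j * even_prod (2 * n - j)) $ 0 \<noteq> 0"
    by (simp add: even_prod_nth_0)
qed

text \<open>The difference from the partial theta sum is a sum over j of a bracket times
  X^((j-n)^2), and each summand vanishes modulo X^(N+1): the monomial does if |j - n| > N, otherwise
  the bracket does.\<close>

lemma theta_product_limit: "(\<lambda>n. (odd_prod n)\<^sup>2 * even_prod n) \<longlonglongrightarrow> theta"
proof (rule tendsto_fpsI)
  fix N
  have "\<forall>\<^sub>F n in sequentially. (\<Sum>j\<le>2 * n. fps_X ^ nat ((int j - int n)\<^sup>2)) $ N = theta $ N"
    using partial_theta_limit by (simp add: tendsto_fps_iff)
  \<comment> \<open>With this bound, |j - n| \<le> N forces both j and 2n - j to be at least N +
    1.\<close>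
  moreover have "\<forall>\<^sub>F n in sequentially. 2 * Suc N \<le> n" by (rule eventually_ge_at_top)
  ultimately show "\<forall>\<^sub>F n in sequentially. ((odd_prod n)\<^sup>2 * even_prod n) $ N = theta $ N"
  proof eventually_elim
    case (elim n)
    have "fps_X ^ Suc N dvd
        (qbinomial ((fps_X :: rat fps)\<^sup>2) (2 * n) j * even_prod n - 1) * fps_X ^ nat ((int j - int n)\<^sup>2)"
      if "j \<le> 2 * n" for j
    proof (cases "int N < \<bar>int j - int n\<bar>")
      case True
      also have "\<bar>int j - int n\<bar> \<le> (int j - int n)\<^sup>2"
        by (rule abs_le_power2_int)
      finally have "Suc N \<le> nat ((int j - int n)\<^sup>2)" by simp
      then show ?thesis by (intro dvd_mult le_imp_power_dvd)
    next
      case False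
      then have "int j - int n \<le> int N" "int n - int j \<le> int N" by auto
      with elim(2) that show ?thesis
        by (intro dvd_mult2 qbinomial_even_prod_cong) auto
    qed
    then have "fps_X ^ Suc N dvd (\<Sum>j\<le>2 * n.
        (qbinomial ((fps_X :: rat fps)\<^sup>2) (2 * n) j * even_prod n - 1) * fps_X ^ nat ((int j - int n)\<^sup>2))"
      by (intro dvd_sum) auto
    also have "\<dots> = (odd_prod n)\<^sup>2 * even_prod n - (\<Sum>j\<le>2 * n. fps_X ^ nat ((int j - int n)\<^sup>2))"
      by (simp add: odd_prod_squared sum_distrib_right sum_distrib_left sum_subtractf algebra_simps)
    finally obtain k where "(odd_prod n)\<^sup>2 * even_prod n -
        (\<Sum>j\<le>2 * n. fps_X ^ nat ((int j - int n)\<^sup>2)) = fps_X ^ Suc N * k" ..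
    then have "((odd_prod n)\<^sup>2 * even_prod n -
        (\<Sum>j\<le>2 * n. fps_X ^ nat ((int j - int n)\<^sup>2))) $ N = 0"
      by (simp only: fps_X_power_mult_nth) simp
    with elim(1) show ?case by simp
  qed
qed

section \<open>Theta identities\<close>

lemma odd_prod_compose_uminus: "odd_prod n oo - fps_X = odd_prod_neg n"
  unfolding odd_prod_def odd_prod_neg_def
  by (simp add: fps_compose_prod_distrib fps_compose_add_distrib fps_compose_mult_distrib
      fps_X_power_compose)

lemma even_prod_compose_uminus: "even_prod n oo - fps_X = even_prod n"
  unfolding even_prod_def
  by (simp add: fps_compose_prod_distrib fps_compose_sub_distrib fps_X_power_compose
      del: power_Suc mult_Suc_right)

lemma theta_uminus_product_limit:
  "(\<lambda>n. (odd_prod_neg n)\<^sup>2 * even_prod n) \<longlonglongrightarrow> (theta oo - fps_X)"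
  using tendsto_compose_fps[OF theta_product_limit, of "- fps_X"]
  by (simp add: fps_compose_mult_distrib fps_compose_power[symmetric]
      odd_prod_compose_uminus even_prod_compose_uminus)

lemma odd_prod_mult_neg: "odd_prod n * odd_prod_neg n = odd_prod_neg n oo fps_X\<^sup>2"
proof -
  have "odd_prod_neg n oo fps_X\<^sup>2 = (\<Prod>i<n. 1 - (fps_X\<^sup>2) ^ (2 * i + 1))"
    unfolding odd_prod_neg_def
    by (simp add: fps_compose_prod_distrib fps_compose_sub_distrib fps_X_power_compose
        del: power_Suc)
  also have "\<dots> = (\<Prod>i<n. (1 + fps_X ^ (2 * i + 1)) * (1 - fps_X ^ (2 * i + 1)))"
    by (rule prod.cong) (simp_all add: algebra_simps power2_eq_square power_mult_distrib)
  finally show ?thesis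
    by (simp only: odd_prod_def odd_prod_neg_def prod.distrib)
qed

text \<open>The exponents 2, 4, ..., 4n are the doubles of the odd and of the even numbers up to
  2n.\<close>

lemma even_prod_double: "even_prod (2 * n) = (odd_prod_neg n * even_prod n) oo fps_X\<^sup>2"
proof -
  have "even_prod (2 * n) = (\<Prod>i<n. (1 - (fps_X\<^sup>2) ^ (2 * i + 1)) * (1 - (fps_X\<^sup>2) ^ (2 * Suc i)))"
    unfolding even_prod_def power_mult[symmetric] by (induction n) simp_all
  then show ?thesis
    unfolding odd_prod_neg_def even_prod_def prod.distrib
    by (simp add: fps_compose_prod_distrib fps_compose_sub_distrib fps_compose_mult_distrib
        fps_X_power_compose del: power_Suc)
qed

lemma odd_prod_convergent: "convergent odd_prod"
proof -
  have eq: "odd_prod = (\<lambda>n. \<Prod>i<n. 1 + fps_X ^ Suc i * fps_X ^ i)"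
    by (auto simp: odd_prod_def fun_eq_iff power_add[symmetric] mult_2 intro!: prod.cong)
  show ?thesis unfolding eq by (rule convergent_prod_one_plus_X_power)
qed

lemma odd_prod_neg_convergent: "convergent odd_prod_neg"
proof -
  have eq: "odd_prod_neg = (\<lambda>n. \<Prod>i<n. 1 + fps_X ^ Suc i * - (fps_X ^ i))"
    by (auto simp: odd_prod_neg_def fun_eq_iff power_add[symmetric] mult_2 intro!: prod.cong)
  show ?thesis unfolding eq by (rule convergent_prod_one_plus_X_power)
qed

lemma even_prod_convergent: "convergent even_prod"
proof -
  have eq: "even_prod = (\<lambda>n. \<Prod>i<n. 1 + fps_X ^ Suc i * - (fps_X ^ Suc i))"
    by (rule ext) (rule even_prod_eq)
  show ?thesis unfolding eq by (rule convergent_prod_one_plus_X_power)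
qed

text \<open>With P, M, D the limits of the three products, theta(q) = P^2 D and theta(-q) = M^2 D,
  while P = O M.\<close>

lemma theta_eq_uminus_mult_series:
  "theta = (theta oo - fps_X) * odd_overpartition_series\<^sup>2"
proof -
  obtain P where P: "odd_prod \<longlonglongrightarrow> P" using odd_prod_convergent convergent_def by blast
  obtain M where M: "odd_prod_neg \<longlonglongrightarrow> M" using odd_prod_neg_convergent convergent_def by blast
  obtain D where D: "even_prod \<longlonglongrightarrow> D" using even_prod_convergent convergent_def by blast
  have "odd_prod \<longlonglongrightarrow> odd_overpartition_series * M"
    using tendsto_mult_fps[OF odd_overpartition_series_limit M]
    by (simp only: gen_fun_overpartitions_in_odd)
  with P have OM: "P = odd_overpartition_series * M" by (rule LIMSEQ_unique)
  have "theta = P\<^sup>2 * D"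
    by (rule LIMSEQ_unique[OF theta_product_limit]) (intro tendsto_mult_fps tendsto_power_fps P D)
  moreover have "theta oo - fps_X = M\<^sup>2 * D"
    by (rule LIMSEQ_unique[OF theta_uminus_product_limit]) (intro tendsto_mult_fps tendsto_power_fps M D)
  ultimately show ?thesis by (simp add: OM power_mult_distrib mult_ac)
qed

text \<open>The left side is M(q^2)^2 D(q)^2, and D(q) = M(q^2) D(q^2). Together they give the
  square of M(q^2)^2 D(q^2), which is theta(-q) with q replaced by q^2.\<close>

lemma theta_mult_theta_uminus: "theta * (theta oo - fps_X) = ((theta oo - fps_X) oo fps_X\<^sup>2)\<^sup>2"
proof -
  obtain D where D: "even_prod \<longlonglongrightarrow> D" using even_prod_convergent convergent_def by blast
  let ?f = "\<lambda>n. ((odd_prod n)\<^sup>2 * even_prod n) * ((odd_prod_neg n)\<^sup>2 * even_prod n)"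
  let ?r = "\<lambda>n. (odd_prod_neg n oo fps_X\<^sup>2)\<^sup>2"
  let ?d = "\<lambda>n. even_prod (2 * n)"
  \<comment> \<open>Splitting by parity needs products of even length, hence this
    subsequence.\<close>
  have D2: "?d \<longlonglongrightarrow> D"
    using LIMSEQ_subseq_LIMSEQ[OF D, of "\<lambda>n. 2 * n"] by (simp add: strict_mono_def o_def)
  obtain M where M: "odd_prod_neg \<longlonglongrightarrow> M" using odd_prod_neg_convergent convergent_def by blast
  have R: "?r \<longlonglongrightarrow> (M oo fps_X\<^sup>2)\<^sup>2"
    by (intro tendsto_power_fps tendsto_compose_fps M)
  have eq: "?f = (\<lambda>n. ?r n * (even_prod n)\<^sup>2)"
    unfolding odd_prod_mult_neg[symmetric] by (rule ext) (simp add: power2_eq_square mult_ac)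
  have lim: "?f \<longlonglongrightarrow> theta * (theta oo - fps_X)"
    by (intro tendsto_mult_fps theta_product_limit theta_uminus_product_limit)
  have 1: "theta * (theta oo - fps_X) = (M oo fps_X\<^sup>2)\<^sup>2 * D\<^sup>2"
    by (rule LIMSEQ_unique[OF lim], unfold eq)
      (rule tendsto_mult_fps[OF R tendsto_power_fps[OF D]])
  have "D = (M * D) oo fps_X\<^sup>2"
    by (rule LIMSEQ_unique[OF D2])
      (unfold even_prod_double, intro tendsto_mult_fps tendsto_compose_fps M D)
  then have 2: "D = (M oo fps_X\<^sup>2) * (D oo fps_X\<^sup>2)"
    by (simp add: fps_compose_mult_distrib)
  have "theta oo - fps_X = M\<^sup>2 * D"
    by (rule LIMSEQ_unique[OF theta_uminus_product_limit]) (intro tendsto_mult_fps tendsto_power_fps M D)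
  then have 3: "(theta oo - fps_X) oo fps_X\<^sup>2 = (M oo fps_X\<^sup>2)\<^sup>2 * (D oo fps_X\<^sup>2)"
    by (simp add: fps_compose_mult_distrib fps_compose_power)
  show ?thesis
    unfolding 1 3 by (subst 2) (simp add: power2_eq_square mult_ac)
qed

section \<open>Theta squared and sums of two squares\<close>

lemma theta_squared:
  "theta\<^sup>2 = gen_fun (UNIV \<times> UNIV) (\<lambda>(x :: int, y :: int). nat (x\<^sup>2) + nat (y\<^sup>2))"
  unfolding theta_def power2_eq_square[of "gen_fun _ _"]
  by (rule gen_fun_times[symmetric]; rule finite_theta_fibre)

text \<open>Since (x+y)^2 + (x-y)^2 = 2 (x^2 + y^2), representations of n map to those of 2n. The
  map is onto because an even sum of two squares forces x and y to have the same parity.\<close>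

lemma theta_squared_nth_double: "theta\<^sup>2 $ (2 * n) = theta\<^sup>2 $ n"
proof -
  let ?R = "\<lambda>n. {p \<in> UNIV \<times> UNIV. (\<lambda>(x :: int, y :: int). nat (x\<^sup>2) + nat (y\<^sup>2)) p = n}"
  have R: "?R n = {(x, y). x\<^sup>2 + y\<^sup>2 = int n}" for n
    by (auto simp: nat_add_distrib[symmetric] nat_eq_iff)
  have "bij_betw (\<lambda>(x :: int, y). (x + y, x - y)) {(x, y). x\<^sup>2 + y\<^sup>2 = int n}
      {(x, y). x\<^sup>2 + y\<^sup>2 = int (2 * n)}"
  proof (rule bij_betwI[where g = "\<lambda>(x, y). ((x + y) div 2, (x - y) div 2)"])
    have "\<exists>a b. x = a + b \<and> y = a - b" if "x\<^sup>2 + y\<^sup>2 = int (2 * n)" for x y :: int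
    proof -
      have "even (x\<^sup>2 + y\<^sup>2)" unfolding that by simp
      then have "even (x + y)" by simp
      then obtain a where "x + y = 2 * a" by (rule evenE)
      then show ?thesis
        by (intro exI[of _ a] exI[of _ "x - a"]) auto
    qed
    then show "(\<lambda>(x, y). ((x + y) div 2, (x - y) div 2)) \<in>
        {(x, y). x\<^sup>2 + y\<^sup>2 = int (2 * n)} \<rightarrow> {(x, y). x\<^sup>2 + y\<^sup>2 = int n}"
      and "\<And>p. p \<in> {(x, y). x\<^sup>2 + y\<^sup>2 = int (2 * n)} \<Longrightarrow>
        (\<lambda>(x, y). (x + y, x - y)) ((\<lambda>(x, y). ((x + y) div 2, (x - y) div 2)) p) = p"
      by (fastforce simp: power2_eq_square algebra_simps)+
  qed (auto simp: power2_eq_square algebra_simps)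
  then have "card {(x :: int, y). x\<^sup>2 + y\<^sup>2 = int n} = card {(x :: int, y). x\<^sup>2 + y\<^sup>2 = int (2 * n)}"
    by (rule bij_betw_same_card)
  then show ?thesis unfolding theta_squared gen_fun_nth R by simp
qed

text \<open>On the left the odd coefficients cancel and the even ones double; halving the index of
  an even one does not change it.\<close>

lemma theta_squared_even_part:
  "theta\<^sup>2 + (theta oo - fps_X)\<^sup>2 = 2 * (theta oo fps_X\<^sup>2)\<^sup>2"
proof (rule fps_ext)
  fix n
  have sq: "(theta oo - fps_X)\<^sup>2 = theta\<^sup>2 oo - fps_X" "(theta oo fps_X\<^sup>2)\<^sup>2 = theta\<^sup>2 oo fps_X\<^sup>2"
    by (simp_all add: fps_compose_power)
  show "(theta\<^sup>2 + (theta oo - fps_X)\<^sup>2) $ n = (2 * (theta oo fps_X\<^sup>2)\<^sup>2) $ n"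
    unfolding sq unfolding mult_2[of "theta\<^sup>2 oo _"] fps_add_nth fps_nth_compose_X_squared fps_compose_uminus'
    by (cases "even n") (auto simp: theta_squared_nth_double elim!: evenE)
qed

lemma theta_nth_0: "theta $ 0 = 1"
proof -
  have "{x \<in> (UNIV :: int set). nat (x\<^sup>2) = 0} = {0}" by auto
  then show ?thesis by (simp add: theta_def gen_fun_nth)
qed

text \<open>Replacing q by -q in theta(q) = theta(-q) O(q)^2 gives theta(-q) = theta(q) O(-q)^2;
  combining both yields the second claim. For the first, multiplication by theta(q) theta(-q) turns
  the left side into theta(q)^2 + theta(-q)^2.\<close>

lemma odd_overpartition_series_squared_even_part:
  "odd_overpartition_series\<^sup>2 + (odd_overpartition_series oo - fps_X)\<^sup>2 =
     2 * (odd_overpartition_series oo fps_X\<^sup>2) ^ 4"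
  and odd_overpartition_series_mult_uminus:
  "odd_overpartition_series\<^sup>2 * (odd_overpartition_series oo - fps_X)\<^sup>2 = 1"
proof -
  let ?O = "odd_overpartition_series" and ?M = "theta oo - fps_X"
  let ?N = "odd_overpartition_series oo - fps_X"
  \<comment> \<open>Power series over the rationals form an integral domain, so these factors can be
    cancelled.\<close>
  have nz: "theta \<noteq> 0" "?M \<noteq> 0"
    using theta_nth_0 by (auto dest: arg_cong[where f = "\<lambda>f. f $ 0"])
  have "(theta oo - fps_X) oo - fps_X = theta"
    by (rule fps_ext) (simp add: fps_compose_uminus' mult.assoc[symmetric] power_mult_distrib[symmetric])
  then have M: "?M = theta * ?N\<^sup>2"
    using arg_cong[OF theta_eq_uminus_mult_series, of "\<lambda>f. f oo - fps_X"]
    by (simp add: fps_compose_mult_distrib fps_compose_power)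
  have "theta * (?O\<^sup>2 * ?N\<^sup>2) = ?M * ?O\<^sup>2"
    by (subst M) (simp add: mult_ac)
  also have "\<dots> = theta * 1" using theta_eq_uminus_mult_series by simp
  finally show "?O\<^sup>2 * ?N\<^sup>2 = 1" using nz by simp
  have "theta oo fps_X\<^sup>2 = (?M oo fps_X\<^sup>2) * (?O oo fps_X\<^sup>2)\<^sup>2"
    using arg_cong[OF theta_eq_uminus_mult_series, of "\<lambda>f. f oo fps_X\<^sup>2"]
    by (simp add: fps_compose_mult_distrib fps_compose_power)
  then have sq: "(theta oo fps_X\<^sup>2)\<^sup>2 = (theta * ?M) * (?O oo fps_X\<^sup>2) ^ 4"
    by (simp add: theta_mult_theta_uminus power_mult_distrib power_mult[symmetric])
  have "(theta * ?M) * (?O\<^sup>2 + ?N\<^sup>2) = theta * (?M * ?O\<^sup>2) + ?M * (theta * ?N\<^sup>2)"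
    by (simp add: algebra_simps)
  also have "\<dots> = theta\<^sup>2 + ?M\<^sup>2"
    unfolding theta_eq_uminus_mult_series[symmetric] M[symmetric] by (simp add: power2_eq_square)
  also have "\<dots> = (theta * ?M) * (2 * (?O oo fps_X\<^sup>2) ^ 4)"
    unfolding theta_squared_even_part sq by (simp add: mult_ac)
  finally show "?O\<^sup>2 + ?N\<^sup>2 = 2 * (?O oo fps_X\<^sup>2) ^ 4" using nz by simp
qed

theorem theorem1p1:
  fixes n :: nat
  assumes "n \<ge> 1"
  shows "OPT 4 (2 * n) = 2 * OPT 8 n"
proof -
  let ?O = "odd_overpartition_series" and ?N = "odd_overpartition_series oo - fps_X"
  have "?O ^ 4 + ?N ^ 4 + 2 = (?O\<^sup>2 + ?N\<^sup>2)\<^sup>2"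
    using odd_overpartition_series_mult_uminus
    by (simp add: power2_sum power_mult[symmetric] algebra_simps)
  also have "\<dots> = 4 * (?O ^ 8 oo fps_X\<^sup>2)"
    unfolding odd_overpartition_series_squared_even_part
    by (simp add: power_mult_distrib power_mult[symmetric] fps_compose_power)
  finally have "(?O ^ 4 + (?O ^ 4 oo - fps_X) + 2) $ (2 * n) = (4 * (?O ^ 8 oo fps_X\<^sup>2)) $ (2 * n)"
    by (simp add: fps_compose_power)
  \<comment> \<open>At an even index the sign (-1)^(2n) is 1, so both fourth powers contribute
    equally.\<close>
  then have "2 * (?O ^ 4 $ (2 * n)) = 4 * (?O ^ 8 $ n)"
    using assms by (simp add: fps_compose_uminus' fps_nth_compose_X_squared fps_numeral_nth
        numeral_fps_const)
  then have "of_nat (OPT 4 (2 * n)) = (of_nat (2 * OPT 8 n) :: rat)"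
    by (simp add: OPT_eq_nth_power)
  then show ?thesis by (simp only: of_nat_eq_iff)
qed

end
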